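(* Let $D$ be a triangulated topological disk (a finite simplicial complex consisting of at least one triangle, whose underlying space is homeomorphic to a closed disk), and let $s$ and $t$ be two distinct vertices on the boundary $\partial D$. Then there exists an unfolding path of $D$ from $s$ to $t$.
   Context: The incidence graph of $D$ has one node for each vertex, each edge and each triangle of $D$, with an arc joining two nodes whenever the corresponding faces are incident (a vertex to each edge and triangle containing it, an edge to each triangle containing it). An unfolding path of $D$ from $s$ to $t$ is a path $(s=v_0, X_1, v_1, X_2, \ldots, X_k, v_k=t)$ in this graph that alternates between vertex nodes $v_i$ and non-vertex nodes $X_i$ (edges or triangles), in which consecutive vertices $v_{i-1}, v_i$ are distinct (no vertex is repeated twice in a row), and which covers every triangle of $D$ exactly once, where a triangle node covers itself and an edge node covers the two triangles of $D$ adjacent to that edge. *)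

theory Defs
  imports "HOL-Analysis.Analysis"
begin

definition simplicial_complex2 :: "'v set set \<Rightarrow> bool" where
  "simplicial_complex2 K \<longleftrightarrow> finite K \<and>
     (\<forall>F\<in>K. finite F \<and> F \<noteq> {} \<and> card F \<le> 3) \<and>
     (\<forall>F\<in>K. \<forall>G. G \<subseteq> F \<and> G \<noteq> {} \<longrightarrow> G \<in> K)"

definition vertices :: "'v set set \<Rightarrow> 'v set" where
  "vertices K = {v. {v} \<in> K}"

definition edges :: "'v set set \<Rightarrow> 'v set set" where
  "edges K = {F\<in>K. card F = 2}"

definition triangles :: "'v set set \<Rightarrow> 'v set set" where
  "triangles K = {F\<in>K. card F = 3}"

text \<open>Standard geometric realization: barycentric coordinate functions supported on a face.\<close>
definition realization :: "'v set set \<Rightarrow> ('v \<Rightarrow> real) set" where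
  "realization K = {\<alpha>. (\<forall>v. 0 \<le> \<alpha> v) \<and>
      (\<exists>F\<in>K. {v. \<alpha> v \<noteq> 0} \<subseteq> F \<and> sum \<alpha> F = 1)}"

definition vertex_point :: "'v \<Rightarrow> ('v \<Rightarrow> real)" where
  "vertex_point v = (\<lambda>w. if w = v then 1 else 0)"

definition triangulated_disk :: "'v set set \<Rightarrow> bool" where
  "triangulated_disk K \<longleftrightarrow> simplicial_complex2 K \<and> triangles K \<noteq> {} \<and>
     realization K homeomorphic cball (0::real^2) 1"

text \<open>Vertex on the boundary of the disk: its point is sent to the boundary circle by a
  homeomorphism onto the closed disk (independent of the homeomorphism by invariance of domain).\<close>
definition boundary_vertex :: "'v set set \<Rightarrow> 'v \<Rightarrow> bool" where
  "boundary_vertex K v \<longleftrightarrow> v \<in> vertices K \<and>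
     (\<exists>h g. homeomorphism (realization K) (cball (0::real^2) 1) h g \<and>
            h (vertex_point v) \<in> sphere 0 1)"

definition covers :: "'v set set \<Rightarrow> 'v set \<Rightarrow> 'v set set" where
  "covers K X = (if X \<in> triangles K then {X}
                 else if X \<in> edges K then {T \<in> triangles K. X \<subseteq> T} else {})"

text \<open>Unfolding path (s = v_0, X_1, v_1, ..., X_k, v_k = t): vs = [v_0,...,v_k],
  Xs = [X_1,...,X_k]; X_(i+1) = Xs!i joins vs!i and vs!(i+1).\<close>
definition unfolding_path :: "'v set set \<Rightarrow> 'v \<Rightarrow> 'v \<Rightarrow> 'v list \<Rightarrow> 'v set list \<Rightarrow> bool" where
  "unfolding_path K s t vs Xs \<longleftrightarrow>
     length vs = Suc (length Xs) \<and> hd vs = s \<and> last vs = t \<and>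
     set vs \<subseteq> vertices K \<and>
     (\<forall>i < length Xs. (Xs!i \<in> edges K \<or> Xs!i \<in> triangles K) \<and>
                      vs!i \<in> Xs!i \<and> vs!(Suc i) \<in> Xs!i \<and> vs!i \<noteq> vs!(Suc i)) \<and>
     (\<forall>T\<in>triangles K. card {i. i < length Xs \<and> T \<in> covers K (Xs!i)} = 1)"

end

theory Submission
  imports Defs
begin

text \<open>Only two properties of the disk matter. Its triangles are strongly connected (adjacent
  triangles share an edge), since the disk minus the finitely many vertices is connected; and every
  edge lies in at most two triangles, by invariance of domain. The triangles can therefore be added
  one at a time, each sharing an edge with an earlier one, and an unfolding path between any two
  distinct vertices can be maintained: if the new triangle \<open>abc\<close>, attached along \<open>bc\<close>, contributes
  an endpoint \<open>a\<close> of the path, prepend a step from \<open>a\<close> to whichever of \<open>b\<close>, \<open>c\<close> is not the other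
  endpoint; otherwise reroute the path near the triangle across \<open>bc\<close>.\<close>

section \<open>Trails and the insertion of one triangle\<close>

text \<open>\<open>trail K u A v\<close>: some path from \<open>u\<close> to \<open>v\<close> covers exactly the triangles in \<open>A\<close>, each once;
  the rule \<open>double\<close> is a step through the node of an interior edge.\<close>
inductive trail :: "'v set set \<Rightarrow> 'v \<Rightarrow> 'v set set \<Rightarrow> 'v \<Rightarrow> bool" for K where
  single: "T \<in> triangles K \<Longrightarrow> u \<in> T \<Longrightarrow> v \<in> T \<Longrightarrow> u \<noteq> v \<Longrightarrow> trail K u {T} v"
| double: "T \<in> triangles K \<Longrightarrow> T' \<in> triangles K \<Longrightarrow> T \<noteq> T' \<Longrightarrow> T \<inter> T' = {u, v} \<Longrightarrow> u \<noteq> v \<Longrightarrow>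
    trail K u {T, T'} v"
| append: "trail K u A v \<Longrightarrow> trail K v B w \<Longrightarrow> A \<inter> B = {} \<Longrightarrow> trail K u (A \<union> B) w"

lemma card3_eq:
  assumes "card T = 3" "b \<in> T" "c \<in> T" "b \<noteq> c"
  obtains d where "T = {b, c, d}" "d \<noteq> b" "d \<noteq> c"
proof -
  have "card (T - {b, c}) = 1" using assms by (simp add: card_Diff_subset)
  then obtain d where "T - {b, c} = {d}" by (auto simp: card_1_singleton_iff)
  then have "T = {b, c, d}" "d \<noteq> b" "d \<noteq> c" using assms by auto
  then show thesis using that by blast
qed

lemma trail_sym: "trail K u A v \<Longrightarrow> trail K v A u"
proof (induction rule: trail.induct)
  case (append u A v B w)
  then show ?case using trail.append[of K w B v A u] by (simp add: Un_commute Int_commute)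
qed (auto intro: trail.intros)

lemma trail_step:
  "T \<in> triangles K \<Longrightarrow> u \<in> T \<Longrightarrow> v \<in> T \<Longrightarrow> u \<noteq> v \<Longrightarrow> trail K v A w \<Longrightarrow> T \<notin> A \<Longrightarrow>
    trail K u (insert T A) w"
  using trail.append[of K u "{T}" v A w] trail.single[of T K u v] by simp

text \<open>The new triangle \<open>T\<close> is attached to \<open>T'\<close> along an edge \<open>bc\<close>. If the trail uses \<open>T'\<close>
  alone along \<open>bc\<close>, the two are merged into an edge node; if it uses \<open>T'\<close> alone along \<open>bd\<close>,
  that step becomes \<open>b, c, d\<close>; if it uses an edge node covering \<open>T'\<close> and \<open>T''\<close>, then \<open>T''\<close>
  takes over that step and \<open>T\<close>, \<open>T'\<close> form a loop along \<open>bc\<close>.\<close>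
lemma trail_insert:
  assumes "trail K u A v" "T' \<in> A" "T \<notin> A" "T \<in> triangles K" "card (T \<inter> T') = 2"
  shows "trail K u (insert T A) v"
  using assms
proof (induction rule: trail.induct)
  case (single S u v)
  then have S: "S = T'" "T' \<in> triangles K" "T \<noteq> T'" by auto
  obtain b c where bc: "T \<inter> T' = {b, c}" "b \<noteq> c"
    using single.prems(4) by (auto simp: card_2_iff)
  have "card T' = 3" using S by (simp add: triangles_def)
  then obtain d where d: "T' = {b, c, d}" "d \<noteq> b" "d \<noteq> c"
    using bc by (metis card3_eq insertI1 Int_iff insertCI)
  have *: "trail K x {T, T'} d" if "x = b \<or> x = c" for x
  proof -
    define y where "y = (if x = b then c else b)"
    have "b \<in> T" "c \<in> T" "b \<in> T'" "c \<in> T'" using bc(1) by blast+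
    then have y: "y \<noteq> x" "y \<in> T" "x \<in> T" "y \<noteq> d" "y \<in> T'" "d \<in> T'"
      using that bc(2) d by (auto simp: y_def)
    have "trail K y {T'} d" using y S by (intro trail.single) auto
    show ?thesis
      using trail_step[OF single.prems(3) y(3,2) _ \<open>trail K y {T'} d\<close>] y(1) S by auto
  qed
  have "trail K u {T, T'} v"
  proof (cases "u = d \<or> v = d")
    case True
    moreover have "u \<in> {b, c, d}" "v \<in> {b, c, d}" using single.hyps d S by auto
    ultimately show ?thesis using *[of u] trail_sym[OF *[of v]] single.hyps(4) by auto
  next
    case False
    then have "T \<inter> T' = {u, v}" using single.hyps d S bc by auto
    then show ?thesis using single.prems(3) S single.hyps(4) by (intro trail.double)
  qed
  then show ?case using S by simp
next
  case (double S S' u v)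
  define T'' where "T'' = (if T' = S then S' else S)"
  have "T' = S \<or> T' = S'" using double.prems(1) by simp
  then have T'': "{S, S'} = {T', T''}" "T'' \<noteq> T'" "T'' \<in> triangles K" "T' \<in> triangles K"
    "T' \<inter> T'' = {u, v}"
    using double.hyps(1-4) by (auto simp: T''_def)
  have uv: "u \<in> T'" "v \<in> T'" "u \<in> T''" "v \<in> T''" using T''(5) by blast+
  obtain b c where bc: "T \<inter> T' = {b, c}" "b \<noteq> c"
    using double.prems(4) by (auto simp: card_2_iff)
  have "card T' = 3" using T'' by (simp add: triangles_def)
  then obtain d where d: "T' = {b, c, d}"
    using bc by (metis card3_eq insertI1 Int_iff insertCI)
  have *: "trail K x {T, T', T''} z"
    if x: "x \<in> {b, c}" "z \<in> T''" "x \<in> T''" "z \<noteq> x" for x z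
  proof -
    define y where "y = (if x = b then c else b)"
    have "b \<in> T" "c \<in> T" "b \<in> T'" "c \<in> T'" using bc(1) by blast+
    then have y: "y \<noteq> x" "y \<in> T" "x \<in> T" "y \<in> T'" "x \<in> T'"
      using x(1) bc(2) by (auto simp: y_def)
    have "T \<notin> {T', T''}" using double.prems(2) T''(1) by simp
    have "trail K x {T''} z" using T''(3) x by (intro trail.single) auto
    then have "trail K y {T', T''} z"
      using trail_step[OF T''(4) y(4,5)] y(1) T''(2) by auto
    then show ?thesis
      using trail_step[OF double.prems(3) y(3,2)] y(1) \<open>T \<notin> {T', T''}\<close> by auto
  qed
  \<comment> \<open>The distinct vertices \<open>u\<close> and \<open>v\<close> both lie in
    \<open>T'\<close>, whose only vertex outside \<open>{b, c}\<close> is \<open>d\<close>. So one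
    of them lies on the shared edge and can start the loop; if only \<open>v\<close> does, the trail
    is built backwards and reversed.\<close>
  have "u \<in> {b, c} \<or> v \<in> {b, c}" using uv(1,2) d double.hyps(5) by auto
  then have "trail K u {T, T', T''} v"
    using *[of u v] trail_sym[OF *[of v u]] uv double.hyps(5) by auto
  then show ?case using T'' by simp
next
  case (append u A v B w)
  show ?case
  proof (cases "T' \<in> A")
    case True
    then have "trail K u (insert T A) v" using append by auto
    from trail.append[OF this append.hyps(2)] show ?thesis using append by simp
  next
    case False
    then have "trail K v (insert T B) w" using append by auto
    from trail.append[OF append.hyps(1) this] show ?thesis using append by simp
  qed
qed

section \<open>Growing the family of covered triangles\<close>

text \<open>Induction on the number of triangles in a subfamily. The invariant \<open>good\<close>
  asks for trails between all pairs of distinct vertices, because a new endpoint steps to an old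
  vertex that is chosen only once the other endpoint is known. The premise \<open>conn\<close> is
  connectedness of the dual graph, stated through cuts so that it directly supplies the next
  triangle.\<close>

lemma trail_exists:
  assumes fin: "finite (triangles K)" and ne: "triangles K \<noteq> {}"
    and conn: "\<And>C. C \<subset> triangles K \<Longrightarrow> C \<noteq> {} \<Longrightarrow>
      \<exists>T\<in>triangles K - C. \<exists>T'\<in>C. card (T \<inter> T') = 2"
    and st: "s \<in> \<Union>(triangles K)" "t \<in> \<Union>(triangles K)" "s \<noteq> t"
  shows "trail K s (triangles K) t"
proof -
  define good where "good C \<longleftrightarrow> C \<noteq> {} \<and> C \<subseteq> triangles K \<and>
    (\<forall>s\<in>\<Union>C. \<forall>t\<in>\<Union>C. s \<noteq> t \<longrightarrow> trail K s C t)" for C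
  have "\<exists>C. good C \<and> card C = Suc n" if "n < card (triangles K)" for n
    using that
  proof (induction n)
    case 0
    obtain T where "T \<in> triangles K" using ne by auto
    then have "good {T}" by (auto simp: good_def intro: trail.single)
    then show ?case by (intro exI[of _ "{T}"]) simp
  next
    case (Suc n)
    then obtain C where C: "good C" "card C = Suc n" by auto
    then have "C \<subset> triangles K" "C \<noteq> {}" "finite C"
      using Suc.prems fin by (auto simp: good_def intro: finite_subset)
    then obtain T T' where T: "T \<in> triangles K" "T \<notin> C" "T' \<in> C" "card (T \<inter> T') = 2"
      using conn by blast
    then obtain b c where bc: "T \<inter> T' = {b, c}" "b \<noteq> c" by (auto simp: card_2_iff)
    have "card T = 3" using T by (simp add: triangles_def)
    then obtain a where a: "T = {b, c, a}" "a \<noteq> b" "a \<noteq> c"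
      using bc by (metis card3_eq insertI1 Int_iff insertCI)
    have bcC: "b \<in> \<Union>C" "c \<in> \<Union>C" using bc T by auto
    have new: "trail K a (insert T C) z" if "z \<in> \<Union>C" "z \<noteq> a" for z
    proof -
      obtain y where "y \<in> {b, c}" "y \<noteq> z" using bc by auto
      then have "trail K y C z" "y \<in> T" "a \<noteq> y"
        using C that a bcC unfolding good_def by auto
      then show ?thesis using T a by (auto intro: trail_step)
    qed
    have "trail K x (insert T C) z"
      if xz: "x \<in> \<Union>(insert T C)" "z \<in> \<Union>(insert T C)" "x \<noteq> z" for x z
    \<comment> \<open>The third vertex \<open>a\<close> of \<open>T\<close> may already be a vertex
      of \<open>C\<close>, so the split is by membership in \<Union>\<open>C\<close> and not by
      equality with \<open>a\<close>.\<close>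
    proof (cases "x \<in> \<Union>C \<and> z \<in> \<Union>C")
      case True
      then have "trail K x C z" using C xz by (auto simp: good_def)
      then show ?thesis using T by (intro trail_insert[of K x C z T' T])
    next
      case False
      have *: "y \<in> \<Union>C \<or> y = a" if "y \<in> \<Union>(insert T C)" for y
        using that a bcC by auto
      then have "x = a \<and> z \<in> \<Union>C \<or> z = a \<and> x \<in> \<Union>C" using False xz by metis
      then show ?thesis using new trail_sym[OF new] xz by auto
    qed
    then have "good (insert T C)" using C T by (simp add: good_def)
    moreover have "card (insert T C) = Suc (Suc n)"
      using C T \<open>finite C\<close> by simp
    ultimately show ?case by blast
  qed
  from this[of "card (triangles K) - 1"] obtain C where "good C" "card C = card (triangles K)"
    using fin ne by (metis Suc_diff_1 card_gt_0_iff diff_less zero_less_one)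
  then have "C = triangles K" using card_subset_eq[OF fin, of C] by (simp add: good_def)
  then show ?thesis using \<open>good C\<close> st by (auto simp: good_def)
qed

section \<open>From trails to explicit node sequences\<close>

lemma simplicial_complex2D:
  assumes "simplicial_complex2 K"
  shows "finite K" "F \<in> K \<Longrightarrow> finite F" "F \<in> K \<Longrightarrow> F \<noteq> {}" "F \<in> K \<Longrightarrow> card F \<le> 3"
    "F \<in> K \<Longrightarrow> G \<subseteq> F \<Longrightarrow> G \<noteq> {} \<Longrightarrow> G \<in> K"
  using assms unfolding simplicial_complex2_def by blast+

text \<open>Dropping the head of \<open>ys\<close> merges it with the last entry of
  \<open>xs\<close>, so \<open>ys\<close> is read off unchanged from the junction at index
  \<open>length xs - 1\<close>. This glues the vertex lists of two paths with a common
  endpoint.\<close>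

lemma nth_append_tl:
  assumes "xs \<noteq> []" "ys \<noteq> []" "last xs = hd ys"
  shows "(xs @ tl ys) ! (length xs - 1 + j) = ys ! j"
proof -
  have "xs = butlast xs @ [hd ys]" using assms(1,3) by (metis append_butlast_last_id)
  then have "xs @ tl ys = butlast xs @ [hd ys] @ tl ys" by (metis append.assoc)
  then have "xs @ tl ys = butlast xs @ ys" using assms(2) by simp
  then show ?thesis by (metis length_butlast nth_append_length_plus)
qed

text \<open>The bound \<open>two\<close> makes the edge node in the rule \<open>double\<close> cover
  exactly \<open>T\<close> and \<open>T'\<close>. Coverage is counted by \<open>filter\<close>
  instead of an index set because filtering distributes over concatenation, which is what the rule
  \<open>append\<close> needs.\<close>

lemma trail_imp_path:
  assumes sc: "simplicial_complex2 K"
    and two: "\<forall>e\<in>edges K. card {T \<in> triangles K. e \<subseteq> T} \<le> 2"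
    and "trail K s A t"
  shows "\<exists>vs Xs. length vs = Suc (length Xs) \<and> hd vs = s \<and> last vs = t \<and>
     set vs \<subseteq> vertices K \<and>
     (\<forall>i < length Xs. (Xs!i \<in> edges K \<or> Xs!i \<in> triangles K) \<and>
                      vs!i \<in> Xs!i \<and> vs!(Suc i) \<in> Xs!i \<and> vs!i \<noteq> vs!(Suc i)) \<and>
     (\<forall>T\<in>triangles K. length (filter (\<lambda>X. T \<in> covers K X) Xs) = (if T \<in> A then 1 else 0))"
  using assms(3)
proof (induction rule: trail.induct)
  case (single T u v)
  then have "T \<in> K" by (simp add: triangles_def)
  then have "{u} \<in> K" "{v} \<in> K"
    using simplicial_complex2D(5)[OF sc, of T] single by auto
  then show ?case
    using single by (intro exI[of _ "[u, v]"] exI[of _ "[T]"]) (auto simp: vertices_def covers_def)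
next
  case (double T T' u v)
  have uv: "u \<in> T" "v \<in> T" "{u, v} \<subseteq> T" using double by auto
  moreover have "T \<in> K" using double(1) by (simp add: triangles_def)
  ultimately have "{u} \<in> K" "{v} \<in> K" "{u, v} \<in> K"
    using simplicial_complex2D(5)[OF sc, of T] by auto
  then have e: "{u, v} \<in> edges K" "{u, v} \<notin> triangles K"
    using double by (auto simp: edges_def triangles_def)
  have "finite {S \<in> triangles K. {u, v} \<subseteq> S}"
    using simplicial_complex2D(1)[OF sc] by (simp add: triangles_def)
  moreover have "{T, T'} \<subseteq> {S \<in> triangles K. {u, v} \<subseteq> S}" using double(1,2,4) by auto
  moreover have "card {S \<in> triangles K. {u, v} \<subseteq> S} \<le> card {T, T'}"
    using bspec[OF two e(1)] card_2_iff[of "{T, T'}"] double(3) by metis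
  ultimately have "{T, T'} = {S \<in> triangles K. {u, v} \<subseteq> S}" by (rule card_seteq)
  then have "covers K {u, v} = {T, T'}" using e by (simp add: covers_def)
  then show ?case
    using double e \<open>{u} \<in> K\<close> \<open>{v} \<in> K\<close>
    by (intro exI[of _ "[u, v]"] exI[of _ "[{u, v}]"]) (auto simp: vertices_def)
next
  case (append u A v B w)
  obtain vs Xs where 1: "length vs = Suc (length Xs)" "hd vs = u" "last vs = v"
     "set vs \<subseteq> vertices K"
     "\<forall>i < length Xs. (Xs!i \<in> edges K \<or> Xs!i \<in> triangles K) \<and>
                      vs!i \<in> Xs!i \<and> vs!(Suc i) \<in> Xs!i \<and> vs!i \<noteq> vs!(Suc i)"
     "\<forall>T\<in>triangles K. length (filter (\<lambda>X. T \<in> covers K X) Xs) = (if T \<in> A then 1 else 0)"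
    using append.IH(1) by auto
  obtain ws Ys where 2: "length ws = Suc (length Ys)" "hd ws = v" "last ws = w"
     "set ws \<subseteq> vertices K"
     "\<forall>i < length Ys. (Ys!i \<in> edges K \<or> Ys!i \<in> triangles K) \<and>
                      ws!i \<in> Ys!i \<and> ws!(Suc i) \<in> Ys!i \<and> ws!i \<noteq> ws!(Suc i)"
     "\<forall>T\<in>triangles K. length (filter (\<lambda>X. T \<in> covers K X) Ys) = (if T \<in> B then 1 else 0)"
    using append.IH(2) by auto
  let ?vs = "vs @ tl ws" and ?Xs = "Xs @ Ys"
  have ne: "vs \<noteq> []" "ws \<noteq> []" using 1(1) 2(1) by auto
  \<comment> \<open>Position \<open>length Xs\<close> is the shared vertex and is described by both
    \<open>r\<close> and \<open>l\<close>. Hence both ends of every step can be read in the same one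
    of the two original paths.\<close>
  have r: "?vs ! (length Xs + j) = ws ! j" for j
    using nth_append_tl[OF ne, of j] 1(1,3) 2(2) by simp
  have l: "?vs ! i = vs ! i" if "i \<le> length Xs" for i using that 1(1) by (simp add: nth_append)
  show ?case
  proof (intro exI[of _ ?vs] exI[of _ ?Xs] conjI allI impI ballI)
    show "length ?vs = Suc (length ?Xs)" using 1(1) 2(1) by simp
    show "hd ?vs = u" using 1(2) ne by simp
    show "last ?vs = w" using 1(3) 2(2,3) ne by (cases ws) auto
    show "set ?vs \<subseteq> vertices K" using 1(4) 2(4) ne by (cases ws) auto
    fix i assume i: "i < length ?Xs"
    have *: "(?Xs!i \<in> edges K \<or> ?Xs!i \<in> triangles K) \<and> ?vs!i \<in> ?Xs!i \<and> ?vs!(Suc i) \<in> ?Xs!i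
      \<and> ?vs!i \<noteq> ?vs!(Suc i)"
    proof (cases "i < length Xs")
      case True
      then show ?thesis using 1(5) l[of i] l[of "Suc i"] by (simp add: nth_append)
    next
      case False
      then obtain j where j: "i = length Xs + j" "j < length Ys"
        using i by (metis add_less_cancel_left le_add_diff_inverse length_append not_less)
      then show ?thesis using 2(5) r[of j] r[of "Suc j"] by (simp add: nth_append)
    qed
    show "?Xs!i \<in> edges K \<or> ?Xs!i \<in> triangles K" "?vs!i \<in> ?Xs!i" "?vs!(Suc i) \<in> ?Xs!i"
      "?vs!i \<noteq> ?vs!(Suc i)" using * by blast+
  next
    fix T assume "T \<in> triangles K"
    then show "length (filter (\<lambda>X. T \<in> covers K X) ?Xs) = (if T \<in> A \<union> B then 1 else 0)"
      using 1(6) 2(6) append.hyps(3) by auto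
  qed
qed

section \<open>Geometric simplices inside the realization\<close>

text \<open>The closed simplex spanned by \<open>F\<close> in barycentric coordinates; the
  realization of a finite complex is then a finite union of closed sets.\<close>

definition face_points :: "'v set \<Rightarrow> ('v \<Rightarrow> real) set" where
  "face_points F = {\<alpha>. (\<forall>v. 0 \<le> \<alpha> v) \<and> {v. \<alpha> v \<noteq> 0} \<subseteq> F \<and> sum \<alpha> F = 1}"

lemma realization_eq_Union: "realization K = \<Union>(face_points ` K)"
  by (auto simp: realization_def face_points_def)

lemma closed_face_points: "closed (face_points F)"
proof -
  have "face_points F = {\<alpha>. (\<forall>v. 0 \<le> \<alpha> v) \<and> (\<forall>v. v \<notin> F \<longrightarrow> \<alpha> v = 0) \<and> sum \<alpha> F = 1}"
    by (auto simp: face_points_def)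
  moreover have "closed {\<alpha>::'a \<Rightarrow> real. (\<forall>v. 0 \<le> \<alpha> v) \<and> (\<forall>v. v \<notin> F \<longrightarrow> \<alpha> v = 0) \<and> sum \<alpha> F = 1}"
    by (intro closed_Collect_conj closed_Collect_all closed_Collect_imp closed_Collect_le
        closed_Collect_eq open_Collect_const continuous_on_const continuous_on_sum
        continuous_on_product_coordinates)
  ultimately show ?thesis by simp
qed

text \<open>A point of both simplices is supported on the common vertices, so the coordinates
  dropped from the sum vanish.\<close>

lemma face_points_Int:
  assumes "finite F" "finite G"
  shows "face_points F \<inter> face_points G \<subseteq> face_points (F \<inter> G)"
proof
  fix \<alpha> assume "\<alpha> \<in> face_points F \<inter> face_points G"
  then have *: "\<forall>v. 0 \<le> \<alpha> v" "{v. \<alpha> v \<noteq> 0} \<subseteq> F \<inter> G" "sum \<alpha> F = 1"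
    by (auto simp: face_points_def)
  have "sum \<alpha> (F \<inter> G) = sum \<alpha> F"
    by (rule sum.mono_neutral_left) (use * assms in auto)
  then show "\<alpha> \<in> face_points (F \<inter> G)" using * by (simp add: face_points_def)
qed

lemma face_points_empty [simp]: "face_points {} = {}"
  by (simp add: face_points_def)

lemma face_points_singleton: "face_points {v} \<subseteq> {vertex_point v}"
proof
  fix \<alpha> assume "\<alpha> \<in> face_points {v}"
  then have "{w. \<alpha> w \<noteq> 0} \<subseteq> {v}" "\<alpha> v = 1" by (auto simp: face_points_def)
  then have "\<alpha> w = vertex_point v w" for w by (auto simp: vertex_point_def)
  then show "\<alpha> \<in> {vertex_point v}" by blast
qed

lemma face_points_small:
  assumes "finite F" "card F \<le> 1"
  shows "face_points F \<subseteq> vertex_point ` F"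
proof -
  consider "F = {}" | v where "F = {v}"
    using assms by (metis One_nat_def card_0_eq card_1_singletonE le_Suc_eq le_zero_eq)
  then show ?thesis
  proof cases
    case 2
    then show ?thesis using face_points_singleton[of v] by auto
  qed auto
qed

lemma barycenter_in_face_points:
  assumes "finite F" "F \<noteq> {}"
  shows "(\<lambda>v. if v \<in> F then 1 / real (card F) else 0) \<in> face_points F"
  using assms by (simp add: face_points_def)

text \<open>All coordinates of the barycenter are at most 1/2, whereas a vertex point has a
  coordinate equal to 1.\<close>

lemma face_points_not_vertices:
  assumes "finite F" "card F \<ge> 2"
  shows "\<not> face_points F \<subseteq> range vertex_point"
proof
  assume *: "face_points F \<subseteq> range vertex_point"
  have "F \<noteq> {}" using assms by auto
  from barycenter_in_face_points[OF assms(1) this] *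
  obtain w where "(\<lambda>v. if v \<in> F then 1 / real (card F) else 0) = vertex_point w" by blast
  from fun_cong[OF this, of w] have "(if w \<in> F then 1 / real (card F) else 0) = 1"
    by (simp only: vertex_point_def simp_thms if_True)
  then show False using assms by (auto split: if_splits)
qed

lemma finite_vertices: "simplicial_complex2 K \<Longrightarrow> finite (vertices K)"
  unfolding vertices_def
  by (rule finite_imageD[of "\<lambda>v. {v}"])
     (auto dest: simplicial_complex2D(1) elim!: finite_subset[rotated])

section \<open>Connectivity of the punctured disk and of its triangles\<close>

text \<open>The disk is convex of affine dimension two, hence not collinear, and removing countably
  many points from such a set keeps it connected.\<close>

lemma connected_disk_minus_finite: "finite P \<Longrightarrow> connected (cball (0::real^2) 1 - P)"
  by (rule connected_convex_diff_countable)
     (auto simp: collinear_aff_dim aff_dim_cball intro: countable_finite)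

lemma connected_realization_minus_finite:
  assumes "realization K homeomorphic cball (0::real^2) 1" "finite P"
  shows "connected (realization K - P)"
proof -
  obtain h g where hg: "homeomorphism (realization K) (cball (0::real^2) 1) h g"
    using assms by (auto simp: homeomorphic_def)
  \<comment> \<open>Points of \<open>P\<close> outside the realization are discarded first, since
    \<open>h\<close> is controlled only on the realization.\<close>
  let ?Q = "h ` (P \<inter> realization K)"
  have "realization K - P = g ` (cball 0 1 - ?Q)"
  proof (intro equalityI subsetI)
    fix x assume "x \<in> realization K - P"
    then have "x = g (h x)" "h x \<in> cball 0 1 - ?Q"
      using homeomorphism_apply1[OF hg] homeomorphism_image1[OF hg] by (auto, metis)
    then show "x \<in> g ` (cball 0 1 - ?Q)" by blast
  next
    fix x assume "x \<in> g ` (cball 0 1 - ?Q)"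
    then obtain y where y: "y \<in> cball 0 1 - ?Q" "x = g y" by blast
    then have "h x = y" "x \<in> realization K"
      using homeomorphism_apply2[OF hg] homeomorphism_image2[OF hg] by auto
    then show "x \<in> realization K - P" using y by blast
  qed
  moreover have "continuous_on (cball 0 1 - ?Q) g"
    using hg by (auto simp: homeomorphism_def intro: continuous_on_subset)
  ultimately show ?thesis
    using connected_disk_minus_finite[of ?Q] assms by (simp add: connected_continuous_image)
qed

text \<open>Since a disk minus finitely many points is connected, its complex cannot split into two
  families of faces that meet in finitely many points only.\<close>
lemma face_families_connected:
  assumes hom: "realization K homeomorphic cball (0::real^2) 1"
    and K: "finite K" "K = A \<union> B" and P: "finite P"
    and AB: "\<And>F G. F \<in> A \<Longrightarrow> G \<in> B \<Longrightarrow> face_points F \<inter> face_points G \<subseteq> P"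
  shows "(\<forall>F\<in>A. face_points F \<subseteq> P) \<or> (\<forall>G\<in>B. face_points G \<subseteq> P)"
proof -
  let ?A = "\<Union>(face_points ` A)" and ?B = "\<Union>(face_points ` B)"
  have cl: "closed ?A" "closed ?B" using K by (auto intro!: closed_UN closed_face_points)
  have int: "?A \<inter> ?B \<inter> (realization K - P) = {}" using AB by blast
  have cov: "realization K - P \<subseteq> ?A \<union> ?B" using K by (auto simp: realization_eq_Union)
  have "?A \<inter> (realization K - P) = {} \<or> ?B \<inter> (realization K - P) = {}"
    by (rule connected_closedD[OF connected_realization_minus_finite[OF hom P] int cov cl])
  moreover have "?A \<subseteq> realization K" "?B \<subseteq> realization K"
    using K by (auto simp: realization_eq_Union)
  ultimately have "?A \<subseteq> P \<or> ?B \<subseteq> P" by blast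
  then show ?thesis by blast
qed

text \<open>Split \<open>K\<close> into the faces \<open>A\<close> lying in triangles of
  \<open>C\<close> and the remaining faces \<open>B\<close>. A face in \<open>B\<close> shares at
  most one vertex with a triangle of \<open>C\<close>, so the two families meet only in vertex
  points. As \<open>A\<close> contains a triangle, no face with two or more vertices can be left in
  \<open>B\<close>.\<close>

lemma triangle_family_dominates:
  assumes disk: "triangulated_disk K"
    and C: "C \<subseteq> triangles K" "C \<noteq> {}"
    and closed: "\<And>T T'. T \<in> triangles K - C \<Longrightarrow> T' \<in> C \<Longrightarrow> card (T \<inter> T') \<noteq> 2"
    and F: "F \<in> K" "card F \<ge> 2"
  shows "\<exists>T\<in>C. F \<subseteq> T"
proof (rule ccontr)
  assume notsub: "\<not> (\<exists>T\<in>C. F \<subseteq> T)"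
  have sc: "simplicial_complex2 K" using disk by (simp add: triangulated_disk_def)
  have K: "finite K" "\<And>F. F \<in> K \<Longrightarrow> finite F \<and> card F \<le> 3"
    "\<And>F G. F \<in> K \<Longrightarrow> G \<subseteq> F \<Longrightarrow> G \<noteq> {} \<Longrightarrow> G \<in> K"
    using simplicial_complex2D[OF sc] by blast+
  define A where "A = {F \<in> K. \<exists>T\<in>C. F \<subseteq> T}"
  define B where "B = K - A"
  let ?P = "vertex_point ` vertices K"
  have small: "card (G \<inter> T) \<le> 1" if "G \<in> B" "T \<in> C" for G T
  proof (rule ccontr)
    assume gt: "\<not> card (G \<inter> T) \<le> 1"
    have G: "G \<in> K" "\<not> G \<subseteq> T" using that by (auto simp: B_def A_def)
    then have "card (G \<inter> T) < card G" using K by (intro psubset_card_mono) auto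
    \<comment> \<open>From 1 < \<open>card (G \<inter> T)\<close> < \<open>card G\<close> \<le> 3
      the values are forced: \<open>G\<close> is a triangle outside \<open>C\<close> that shares an
      edge with \<open>T\<close>, contrary to \<open>closed\<close>.\<close>
    then have "card G = 3" "card (G \<inter> T) = 2" using gt K(2)[OF G(1)] by auto
    moreover have "G \<notin> C" using that by (auto simp: B_def A_def)
    ultimately show False using closed[of G T] G that by (simp add: triangles_def)
  qed
  have AB: "face_points F \<inter> face_points G \<subseteq> ?P" if FG: "F \<in> A" "G \<in> B" for F G
  proof -
    obtain T where T: "T \<in> C" "F \<subseteq> T" "F \<in> K" "G \<in> K"
      using FG by (auto simp: A_def B_def)
    have fin: "finite F" "finite G" using T K by auto
    have "card (F \<inter> G) \<le> card (G \<inter> T)" using T fin by (intro card_mono) auto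
    then have "card (F \<inter> G) \<le> 1" using small[of G T] FG T by simp
    then have "face_points F \<inter> face_points G \<subseteq> vertex_point ` (F \<inter> G)"
      using face_points_Int[of F G] face_points_small[of "F \<inter> G"] fin by blast
    moreover have "F \<inter> G \<subseteq> vertices K" using K(3)[OF T(3)] by (auto simp: vertices_def)
    ultimately show ?thesis by blast
  qed
  have "(\<forall>F\<in>A. face_points F \<subseteq> ?P) \<or> (\<forall>G\<in>B. face_points G \<subseteq> ?P)"
    by (rule face_families_connected[of K])
       (use disk K(1) AB finite_vertices[OF sc] in \<open>auto simp: A_def B_def triangulated_disk_def\<close>)
  moreover obtain T where "T \<in> C" using C by blast
  then have "T \<in> K" and "card T = 3" using C by (auto simp: triangles_def)
  with \<open>T \<in> C\<close> have T: "T \<in> A" "card T = 3" "finite T" using K(2) by (auto simp: A_def)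
  moreover have "F \<in> B" using F notsub by (simp add: A_def B_def)
  ultimately have "face_points T \<subseteq> ?P \<or> face_points F \<subseteq> ?P" by blast
  moreover have "\<not> face_points T \<subseteq> range vertex_point" "\<not> face_points F \<subseteq> range vertex_point"
    using face_points_not_vertices[of T] face_points_not_vertices[of F] T F K(2)[OF F(1)] by simp_all
  ultimately show False by blast
qed

text \<open>If no edge crossed the cut, a triangle outside \<open>C\<close> would be contained in
  one of \<open>C\<close>, and equal to it by cardinality.\<close>

lemma disk_strongly_connected:
  assumes "triangulated_disk K" "C \<subset> triangles K" "C \<noteq> {}"
  shows "\<exists>T\<in>triangles K - C. \<exists>T'\<in>C. card (T \<inter> T') = 2"
proof (rule ccontr)
  assume no: "\<not> ?thesis"
  obtain S where S: "S \<in> triangles K" "S \<notin> C" using assms by blast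
  then obtain T where T: "T \<in> C" "S \<subseteq> T"
    using triangle_family_dominates[OF assms(1), of C S] assms no by (auto simp: triangles_def)
  then have "card S = 3" "card T = 3" using S assms by (auto simp: triangles_def)
  then have "S = T" using T by (metis card_subset_eq card.infinite zero_neq_numeral)
  then show False using S T by simp
qed

text \<open>A vertex of a larger face is handled by \<open>triangle_family_dominates\<close> with
  all triangles as the family, where the closure premise is vacuous. Any other vertex would be an
  isolated point of a connected space that also contains a triangle.\<close>

lemma vertex_in_triangle:
  assumes disk: "triangulated_disk K" and v: "v \<in> vertices K"
  shows "v \<in> \<Union>(triangles K)"
proof (cases "\<exists>F\<in>K. v \<in> F \<and> card F \<ge> 2")
  case True
  then obtain F where "F \<in> K" "v \<in> F" "card F \<ge> 2" by blast
  moreover have "triangles K \<noteq> {}" using disk by (simp add: triangulated_disk_def)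
  ultimately show ?thesis using triangle_family_dominates[OF disk, of "triangles K" F] by blast
next
  case False
  have K: "finite K" "\<And>F. F \<in> K \<Longrightarrow> finite F \<and> F \<noteq> {}" "{v} \<in> K"
    using disk v simplicial_complex2D[of K] unfolding triangulated_disk_def vertices_def by blast+
  have iso: "F = {v}" if "F \<in> K" "v \<in> F" for F
  proof -
    have "card F \<le> 1" using False that by force
    then have "card F = 1" using K(2)[OF that(1)] by (simp add: le_Suc_eq)
    then show ?thesis using that by (auto simp: card_1_singleton_iff)
  qed
  obtain T where T: "T \<in> K" "card T = 3"
    using disk by (auto simp: triangulated_disk_def triangles_def)
  \<comment> \<open>The exceptional set is empty: an isolated vertex is disjoint from every other
    face, so connectedness of the whole disk suffices.\<close>
  have "(\<forall>F\<in>{{v}}. face_points F \<subseteq> {}) \<or> (\<forall>G\<in>K - {{v}}. face_points G \<subseteq> {})"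
  proof (rule face_families_connected[of K])
    fix F G assume "F \<in> {{v}}" "G \<in> K - {{v}}"
    then have "F = {v}" "v \<notin> G" "finite G" using iso[of G] K(2)[of G] by blast+
    then have "F \<inter> G = {}" "finite F" "finite G" by auto
    then show "face_points F \<inter> face_points G \<subseteq> {}" using face_points_Int[of F G] by simp
  qed (use disk K(1,3) in \<open>auto simp: triangulated_disk_def\<close>)
  moreover have "T \<in> K - {{v}}" using T by auto
  ultimately have "face_points {v} = {} \<or> face_points T = {}" by blast
  then show ?thesis
    using barycenter_in_face_points[of "{v}"] barycenter_in_face_points[OF K(2)[THEN conjunct1]
      K(2)[THEN conjunct2], OF T(1) T(1)] by auto
qed

section \<open>Invariance of domain at an edge\<close>

text \<open>Two triangles sharing an edge \<open>pq\<close> already fill a neighbourhood of the midpoint of \<open>pq\<close>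
  by invariance of domain, which leaves no room for a third triangle \<open>pqc\<close>.\<close>
lemma edge_in_two_triangles:
  assumes disk: "triangulated_disk K" and e: "card e = 2"
  shows "card {T \<in> triangles K. e \<subseteq> T} \<le> 2"
proof (rule ccontr)
  assume "\<not> ?thesis"
  then have "3 \<le> card {T \<in> triangles K. e \<subseteq> T}" by simp
  then obtain \<T> where \<T>: "\<T> \<subseteq> {T \<in> triangles K. e \<subseteq> T}" "card \<T> = 3"
    by (rule obtain_subset_with_card_n)
  obtain T1 T2 T3 where "\<T> = {T1, T2, T3}" and ne: "T1 \<noteq> T2" and ne3: "T3 \<notin> {T1, T2}"
    using \<T>(2) unfolding card_3_iff by blast
  then have T: "T1 \<in> triangles K" "T2 \<in> triangles K" "T3 \<in> triangles K"
    and sub: "e \<subseteq> T1 \<inter> T2 \<inter> T3"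
    using \<T>(1) by blast+
  obtain p q where pq: "e = {p, q}" "p \<noteq> q" using e by (auto simp: card_2_iff)
  have third: "\<exists>x. S = {p, q, x} \<and> x \<noteq> p \<and> x \<noteq> q" if "S \<in> triangles K" "e \<subseteq> S" for S
    using card3_eq[of S p q] that pq by (auto simp: triangles_def)
  obtain a where a: "T1 = {p, q, a}" "a \<noteq> p" "a \<noteq> q" using third[OF T(1)] sub by auto
  obtain b where b: "T2 = {p, q, b}" "b \<noteq> p" "b \<noteq> q" using third[OF T(2)] sub by auto
  obtain c where c: "T3 = {p, q, c}" "c \<noteq> p" "c \<noteq> q" using third[OF T(3)] sub by auto
  have abc: "a \<noteq> b" "a \<noteq> c" "b \<noteq> c" using a b c ne ne3 by auto
  have inK: "{p, q, a} \<in> K" "{p, q, b} \<in> K" "{p, q, c} \<in> K"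
    using T a b c by (auto simp: triangles_def)
  obtain h g where hg: "homeomorphism (realization K) (cball (0::real^2) 1) h g"
    using disk by (auto simp: triangulated_disk_def homeomorphic_def)
  then have h: "continuous_on (realization K) h" "inj_on h (realization K)"
    by (auto simp: homeomorphism_def intro: inj_on_inverseI)
  \<comment> \<open>The map \<phi> folds a planar region onto the two triangles along
    \<open>pq\<close>. The first coordinate is the weight of \<open>p\<close>, the second is the
    weight of \<open>a\<close> if positive and minus the weight of \<open>b\<close> if negative, and
    \<open>q\<close> takes the rest. On \<open>U\<close> the weights of \<open>p\<close> and
    \<open>q\<close> are positive.\<close>
  define \<phi> :: "real^2 \<Rightarrow> 'a \<Rightarrow> real" where "\<phi> z v =
    (if v = p then z $ 1 else if v = q then 1 - z $ 1 - \<bar>z $ 2\<bar>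
     else if v = a then max (z $ 2) 0 else if v = b then max (- z $ 2) 0 else 0)" for z v
  define U :: "(real^2) set" where "U = {z. 0 < z $ 1 \<and> z $ 1 + \<bar>z $ 2\<bar> < 1}"
  have "open U" unfolding U_def
    by (intro open_Collect_conj open_Collect_less continuous_intros)
  have \<phi>cont: "continuous_on U \<phi>"
  proof (rule continuous_on_coordinatewise_then_product)
    fix v show "continuous_on U (\<lambda>z. \<phi> z v)"
      unfolding \<phi>_def
      by (cases "v = p"; cases "v = q"; cases "v = a"; cases "v = b")
         (simp_all, (intro continuous_intros)+)
  qed
  have \<phi>R: "\<phi> z \<in> realization K" if "z \<in> U" for z
  proof (cases "z $ 2 \<ge> 0")
    case True
    then have "\<phi> z \<in> face_points {p, q, a}"
      using that a b abc pq by (auto simp: face_points_def \<phi>_def U_def)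
    then show ?thesis using inK by (auto simp: realization_eq_Union)
  next
    case False
    then have "\<phi> z \<in> face_points {p, q, b}"
      using that a b abc pq by (auto simp: face_points_def \<phi>_def U_def)
    then show ?thesis using inK by (auto simp: realization_eq_Union)
  qed
  have \<phi>inj: "inj_on \<phi> U"
  proof (rule inj_onI)
    fix y z assume "\<phi> y = \<phi> z"
    then have "\<phi> y p = \<phi> z p" "\<phi> y a = \<phi> z a" "\<phi> y b = \<phi> z b" by auto
    then have "y $ 1 = z $ 1" "y $ 2 = z $ 2"
      using a b abc pq by (auto simp: \<phi>_def max_def split: if_splits)
    then show "y = z" by (simp add: vec_eq_iff forall_2)
  qed
  have "continuous_on U (h \<circ> \<phi>)"
    by (rule continuous_on_compose[OF \<phi>cont]) (use h \<phi>R in \<open>auto intro: continuous_on_subset\<close>)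
  moreover have "inj_on (h \<circ> \<phi>) U"
    by (rule comp_inj_on[OF \<phi>inj]) (use h \<phi>R in \<open>auto intro: inj_on_subset\<close>)
  \<comment> \<open>Source and target are both the plane, so the image is open in the plane itself
    and not merely relative to the disk.\<close>
  ultimately have W: "open ((h \<circ> \<phi>) ` U)" using \<open>open U\<close> invariance_of_domain by blast

  \<comment> \<open>A segment leaving the midpoint of \<open>pq\<close> into the third triangle:
    weight \<open>x\<close> moves from \<open>q\<close> to \<open>c\<close> while \<open>p\<close>
    keeps 1/2.\<close>
  define \<psi> :: "real \<Rightarrow> 'a \<Rightarrow> real" where "\<psi> x v =
    (if v = p then 1/2 else if v = q then 1/2 - x else if v = c then x else 0)" for x v
  have \<psi>R: "\<psi> x \<in> realization K" if "x \<in> {0..1/2}" for x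
  proof -
    have "\<psi> x \<in> face_points {p, q, c}"
      using that c pq by (auto simp: face_points_def \<psi>_def)
    then show ?thesis using inK by (auto simp: realization_eq_Union)
  qed
  have \<psi>cont: "continuous_on {0..1/2} \<psi>"
  proof (rule continuous_on_coordinatewise_then_product)
    fix v show "continuous_on {0..1/2} (\<lambda>x. \<psi> x v)"
      unfolding \<psi>_def
      by (cases "v = p"; cases "v = q"; cases "v = c") (simp_all, (intro continuous_intros)+)
  qed
  have "continuous_on {0..1/2} (h \<circ> \<psi>)"
    by (rule continuous_on_compose[OF \<psi>cont]) (use h \<psi>R in \<open>auto intro: continuous_on_subset\<close>)
  then have lim: "((h \<circ> \<psi>) \<longlongrightarrow> (h \<circ> \<psi>) 0) (at 0 within {0..1/2})"
    unfolding continuous_on_def by (metis atLeastAtMost_iff half_gt_zero less_imp_le order_refl zero_less_one)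
  \<comment> \<open>The parameter of the midpoint of \<open>pq\<close> under \<phi>, where the
    segment \<psi> starts.\<close>
  define m :: "real^2" where "m = (\<chi> i. if i = 1 then 1/2 else 0)"
  have m: "m $ 1 = 1/2" "m $ 2 = 0" by (simp_all add: m_def)
  then have "m \<in> U" "\<psi> 0 = \<phi> m" by (auto simp: U_def \<psi>_def \<phi>_def)
  then have "(h \<circ> \<psi>) 0 \<in> (h \<circ> \<phi>) ` U" by auto
  from topological_tendstoD[OF lim W this]
  have "\<forall>\<^sub>F x in at_right 0. (h \<circ> \<psi>) x \<in> (h \<circ> \<phi>) ` U"
    by (simp add: at_within_Icc_at_right)
  moreover have "\<forall>\<^sub>F x in at_right (0::real). x \<in> {0<..<1/2}"
    by (rule eventually_at_right_real) simp
  ultimately have "\<forall>\<^sub>F x in at_right 0. x \<in> {0<..<1/2} \<and> (h \<circ> \<psi>) x \<in> (h \<circ> \<phi>) ` U"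
    by (simp add: eventually_conj_iff)
  then obtain x where x: "x \<in> {0<..<1/2}" "(h \<circ> \<psi>) x \<in> (h \<circ> \<phi>) ` U"
    using eventually_happens'[OF trivial_limit_at_right_real] by blast
  then obtain z where z: "z \<in> U" "h (\<psi> x) = h (\<phi> z)" by auto
  then have "\<psi> x = \<phi> z" using h \<phi>R \<psi>R x by (auto dest: inj_onD)
  \<comment> \<open>The coordinate at \<open>c\<close> separates the two maps: it equals
    \<open>x\<close> > 0 on the segment and 0 throughout the image of \<phi>.\<close>
  then have "\<psi> x c = \<phi> z c" by simp
  then show False using c abc x by (simp add: \<psi>_def \<phi>_def)
qed

section \<open>Assembly of the unfolding path\<close>

theorem theorem1:
  fixes K :: "'v set set" and s t :: 'v
  assumes "triangulated_disk K"
    and "boundary_vertex K s" and "boundary_vertex K t" and "s \<noteq> t"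
  shows "\<exists>vs Xs. unfolding_path K s t vs Xs"
proof -
  have sc: "simplicial_complex2 K" and ne: "triangles K \<noteq> {}"
    using assms(1) by (auto simp: triangulated_disk_def)
  have fin: "finite (triangles K)"
    using simplicial_complex2D(1)[OF sc] by (simp add: triangles_def)
  have "s \<in> vertices K" "t \<in> vertices K"
    using assms(2,3) unfolding boundary_vertex_def by blast+
  then have "s \<in> \<Union>(triangles K)" "t \<in> \<Union>(triangles K)"
    using vertex_in_triangle[OF assms(1)] by blast+
  then have "trail K s (triangles K) t"
    using trail_exists[OF fin ne disk_strongly_connected[OF assms(1)]] assms(4) by blast
  moreover have "\<forall>e\<in>edges K. card {T \<in> triangles K. e \<subseteq> T} \<le> 2"
    using edge_in_two_triangles[OF assms(1)] by (simp add: edges_def)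
  ultimately obtain vs Xs where path: "length vs = Suc (length Xs)" "hd vs = s" "last vs = t"
    "set vs \<subseteq> vertices K"
    "\<forall>i < length Xs. (Xs!i \<in> edges K \<or> Xs!i \<in> triangles K) \<and>
      vs!i \<in> Xs!i \<and> vs!(Suc i) \<in> Xs!i \<and> vs!i \<noteq> vs!(Suc i)"
    and count: "\<forall>T\<in>triangles K. length (filter (\<lambda>X. T \<in> covers K X) Xs)
      = (if T \<in> triangles K then 1 else 0)"
    using trail_imp_path[OF sc] by blast
  have "\<forall>T\<in>triangles K. card {i. i < length Xs \<and> T \<in> covers K (Xs!i)} = 1"
    using count by (simp add: length_filter_conv_card)
  with path have "unfolding_path K s t vs Xs" unfolding unfolding_path_def by blast
  then show ?thesis by blast
qed

end
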